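(* For any class $i\in\{0,1\}$ with continuous sample distribution $P_i$, the mutual-transfer probability $$\mathrm{P}_{\mathrm{MT},i}=\mathrm{P}\big({\bf Y}\in\mathcal{T}_\epsilon({\bf X}),\ {\bf X}\in\mathcal{T}_\epsilon({\bf Y})\big),$$ where ${\bf X},{\bf Y}$ are i.i.d. with distribution $P_i$, satisfies $\mathrm{P}_{\mathrm{MT},i}\to0$ as $\epsilon\to0$ (through $\epsilon>0$).
   Context: Setting: $\mathcal{X}=\mathbb{R}^n$ is the sample space, $\mathcal{C}=\{0,1\}$ the label space, $f:\mathcal{X}\to\mathcal{C}$ a classifier, and for each class $i\in\mathcal{C}$, $P_i$ is a continuous probability distribution on $\mathcal{X}$ (i.e. one admitting a density with respect to Lebesgue measure), the sample distribution of class $i$. All events whose probabilities appear are assumed measurable. For ${\bf x}\in\mathcal{X}$, ${\bf v}^*({\bf x})$ denotes an optimal solution of: minimize $\|{\bf v}\|_2$ over ${\bf v}\in\mathcal{X}$ subject to $f({\bf x}+{\bf v})\neq f({\bf x})$ (such a solution is assumed to exist for $P_i$-almost every ${\bf x}$). $\epsilon$-solution set: for $\epsilon>0$, $$\mathcal{V}_\epsilon({\bf x})=\{{\bf v}\in\mathcal{X} : \|{\bf v}\|_2-\|{\bf v}^*({\bf x})\|_2\le\epsilon,\ f({\bf x}+{\bf v})\neq f({\bf x})\}.$$ Transferable set: $$\mathcal{T}_\epsilon({\bf x})=\{{\bf y}\in\mathcal{X} : f({\bf y})=f({\bf x}),\ \exists\,{\bf v}\in\mathcal{V}_\epsilon({\bf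 x})\text{ such that } f({\bf y}+{\bf v})\neq f({\bf y})\}.$$ *)

theory Defs
  imports "HOL-Probability.Probability"
begin

definition labels :: "nat set" where
  "labels = {0, 1}"

text \<open>A continuous distribution on \<open>\<real>\<^sup>n\<close> is one with a density with respect to Lebesgue
  measure; the continuity of the density itself is not required.\<close>

definition continuous_distribution :: "(real ^ 'n) measure \<Rightarrow> bool" where
  "continuous_distribution D \<longleftrightarrow>
     prob_space D \<and> (\<exists>g \<in> borel_measurable lborel. D = density lborel g)"

definition optimal_perturbation ::
    "(real ^ 'n \<Rightarrow> nat) \<Rightarrow> real ^ 'n \<Rightarrow> real ^ 'n \<Rightarrow> bool" where
  "optimal_perturbation f x v \<longleftrightarrow> is_arg_min norm (\<lambda>w. f (x + w) \<noteq> f x) v"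

text \<open>The selection \<open>vs\<close> of optimal perturbations is a parameter of the sets below. It is
  meant to satisfy \<open>optimal_perturbation f x (vs x)\<close> for almost every \<open>x\<close> only; elsewhere its
  value is arbitrary.\<close>

definition eps_solutions ::
    "(real ^ 'n \<Rightarrow> nat) \<Rightarrow> (real ^ 'n \<Rightarrow> real ^ 'n) \<Rightarrow> real \<Rightarrow> real ^ 'n \<Rightarrow> (real ^ 'n) set" where
  "eps_solutions f vs \<epsilon> x = {v. norm v - norm (vs x) \<le> \<epsilon> \<and> f (x + v) \<noteq> f x}"

definition transferable ::
    "(real ^ 'n \<Rightarrow> nat) \<Rightarrow> (real ^ 'n \<Rightarrow> real ^ 'n) \<Rightarrow> real \<Rightarrow> real ^ 'n \<Rightarrow> (real ^ 'n) set" where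
  "transferable f vs \<epsilon> x =
     {y. f y = f x \<and> (\<exists>v \<in> eps_solutions f vs \<epsilon> x. f (y + v) \<noteq> f y)}"

definition mutual_transfer_event ::
    "'w measure \<Rightarrow> (real ^ 'n \<Rightarrow> nat) \<Rightarrow> (real ^ 'n \<Rightarrow> real ^ 'n) \<Rightarrow>
     ('w \<Rightarrow> real ^ 'n) \<Rightarrow> ('w \<Rightarrow> real ^ 'n) \<Rightarrow> real \<Rightarrow> 'w set" where
  "mutual_transfer_event M f vs X Y \<epsilon> =
     {\<omega> \<in> space M. Y \<omega> \<in> transferable f vs \<epsilon> (X \<omega>) \<and> X \<omega> \<in> transferable f vs \<epsilon> (Y \<omega>)}"

end

theory Submission imports Defs begin

text \<open>The norm of an optimal perturbation of \<open>x\<close> is the distance of \<open>x\<close> to the set of points with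
  another label. Mutual transfer forces \<open>X\<close> and \<open>Y\<close> to have the same label, and their
  distances to the opposite class to be positive and to differ by at most \<open>\<epsilon>\<close>. The probability of
  the latter tends to the probability that the two distances are equal and positive, which
  vanishes by Fubini because the level sets of a distance function at positive levels have
  Lebesgue measure zero.\<close>

lemma infdist_closure [simp]: "infdist x (closure A) = infdist x A"
  by (simp add: infdist_eq_setdist)

text \<open>The piece of the level set whose nearest points in \<open>closure A\<close> lie near \<open>q\<close> meets every ray
  from \<open>q\<close> at most once: if \<open>a\<close> is a nearest point of \<open>x\<close>, then \<open>q\<close> lies inside the ball of
  radius \<open>c\<close> about \<open>a\<close> while \<open>x\<close> lies on its boundary, so the rest of the segment from \<open>q\<close> to
  \<open>x\<close> is closer to \<open>A\<close> than \<open>c\<close>.\<close>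

lemma negligible_level_set_near:
  fixes A :: "'a::euclidean_space set"
  assumes "c > 0"
  shows "negligible {x. infdist x A = c \<and> infdist x (closure A \<inter> cball q (c / 2)) = c}"
    (is "negligible ?S")
proof (rule starlike_negligible)
  let ?B = "closure A \<inter> cball q (c / 2)"
  have "closed ({x. infdist x A = c} \<inter> {x. infdist x ?B = c})"
    by (intro closed_Int closed_Collect_eq continuous_intros)
  then show "closed ?S"
    by (simp add: Collect_conj_eq)
  have outer: "q + t *\<^sub>R u \<notin> ?S" if x: "q + u \<in> ?S" and t: "0 \<le> t" "t < 1" for t u
  proof -
    \<comment> \<open>By convention the distance to the empty set is 0, which \<open>c > 0\<close>
      rules out.\<close>
    have ne: "?B \<noteq> {}"
      using x \<open>c > 0\<close> by (auto simp: infdist_def)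
    have "closed ?B"
      by blast
    from infdist_attains_inf[OF this ne, of "q + u"]
    obtain a where a: "a \<in> closure A" "a \<in> cball q (c / 2)"
      and "infdist (q + u) ?B = dist (q + u) a"
      by blast
    then have dist_a: "dist (q + u) a = c"
      using x by simp
    have "q + t *\<^sub>R u - a = (1 - t) *\<^sub>R (q - a) + t *\<^sub>R (q + u - a)"
      by (simp add: algebra_simps)
    then have "dist (q + t *\<^sub>R u) a \<le> (1 - t) * dist q a + t * dist (q + u) a"
      using t norm_triangle_ineq[of "(1 - t) *\<^sub>R (q - a)" "t *\<^sub>R (q + u - a)"]
      by (simp add: dist_norm)
    also have "\<dots> \<le> (1 - t) * (c / 2) + t * c"
      using a dist_a t by (intro add_mono mult_left_mono) auto
    also have "\<dots> < c"
      using t \<open>c > 0\<close> by (simp add: field_simps)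
    finally have "infdist (q + t *\<^sub>R u) (closure A) < c"
      using infdist_le[OF a(1), of "q + t *\<^sub>R u"] by linarith
    then show ?thesis
      by simp
  qed
  show "t = 1" if tu: "q + t *\<^sub>R u \<in> ?S" "0 \<le> t" "q + u \<in> ?S" for t u
  proof (rule ccontr)
    assume "t \<noteq> 1"
    then consider "t < 1" | "t > 1" by linarith
    then show False
    proof cases
      case 1
      then show False using outer tu by blast
    next
      case 2
      \<comment> \<open>Now \<open>q + t *\<^sub>R u\<close> is the farther point: seen from it,
        \<open>q + u\<close> lies at the fraction \<open>1 / t < 1\<close> of the segment from
        \<open>q\<close>.\<close>
      then have "q + (1 / t) *\<^sub>R (t *\<^sub>R u) \<notin> ?S"
        by (intro outer[OF tu(1)]) auto
      then show False using 2 tu by auto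
    qed
  qed
qed

text \<open>Each point of the level set has a nearest point \<open>a\<close> in
  \<open>closure A\<close>, and a countable dense set has a member \<open>q\<close> within
  \<open>c / 2\<close> of \<open>a\<close>. Hence countably many of the negligible pieces cover the
  level set.\<close>

lemma negligible_infdist_level_set:
  fixes A :: "'a::euclidean_space set"
  assumes "c > 0"
  shows "negligible {x. infdist x A = c}"
proof -
  obtain D :: "'a set" where D: "countable D" "\<And>S. open S \<Longrightarrow> S \<noteq> {} \<Longrightarrow> \<exists>d\<in>D. d \<in> S"
    using countable_dense_setE by metis
  let ?N = "\<lambda>q. {x. infdist x A = c \<and> infdist x (closure A \<inter> cball q (c / 2)) = c}"
  have "negligible (\<Union>(?N ` D))"
    using D(1) negligible_level_set_near[OF assms] by (intro negligible_countable_Union) auto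
  moreover have "{x. infdist x A = c} \<subseteq> \<Union>(?N ` D)"
  proof
    fix x assume "x \<in> {x. infdist x A = c}"
    then have x: "infdist x A = c" by simp
    then have ne: "closure A \<noteq> {}"
      using assms by (auto simp: infdist_def)
    obtain a where a: "a \<in> closure A" "infdist x (closure A) = dist x a"
      using infdist_attains_inf[OF closed_closure ne] by blast
    obtain q where q: "q \<in> D" "q \<in> ball a (c / 2)"
      using D(2)[of "ball a (c / 2)"] assms by auto
    have mem: "a \<in> closure A \<inter> cball q (c / 2)"
      using a q by (auto simp: dist_commute)
    have "infdist x (closure A \<inter> cball q (c / 2)) = c"
    proof (rule antisym)
      show "infdist x (closure A \<inter> cball q (c / 2)) \<le> c"
        using infdist_le[OF mem, of x] a x by simp
      have "closure A \<inter> cball q (c / 2) \<noteq> {}"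
        using mem by blast
      from infdist_mono[OF Int_lower1 this, of x]
      show "c \<le> infdist x (closure A \<inter> cball q (c / 2))"
        using x by simp
    qed
    then show "x \<in> \<Union>(?N ` D)"
      using q x by auto
  qed
  ultimately show ?thesis
    by (rule negligible_subset)
qed

lemma AE_infdist_neq:
  fixes D :: "(real ^ 'n) measure"
  assumes "continuous_distribution D" "c > 0"
  shows "AE x in D. infdist x A \<noteq> c"
proof -
  obtain g where g: "g \<in> borel_measurable lborel" "D = density lborel g"
    using assms by (auto simp: continuous_distribution_def)
  have "AE x in lebesgue. infdist x A \<noteq> c"
    using negligible_infdist_level_set[OF assms(2), of A]
    by (intro AE_I'[of "{x. infdist x A = c}"]) (auto simp: negligible_iff_null_sets)
  then have "AE x in lborel. infdist x A \<noteq> c"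
    by (simp add: AE_completion_iff)
  then show ?thesis
    using g by (auto simp: AE_density elim: eventually_mono)
qed

lemma norm_optimal_perturbation:
  assumes "optimal_perturbation f x v"
  shows "norm v = infdist x {z. f z \<noteq> f x}" "norm v > 0"
proof -
  have v: "f (x + v) \<noteq> f x" and min: "\<And>w. f (x + w) \<noteq> f x \<Longrightarrow> norm v \<le> norm w"
    using assms by (auto simp: optimal_perturbation_def is_arg_min_def not_less)
  show "norm v = infdist x {z. f z \<noteq> f x}"
  proof (rule antisym)
    have "norm v \<le> dist x z" if "f z \<noteq> f x" for z
      using min[of "z - x"] that by (simp add: dist_norm norm_minus_commute)
    then show "norm v \<le> infdist x {z. f z \<noteq> f x}"
      using v by (auto simp: infdist_def intro!: cINF_greatest)
    show "infdist x {z. f z \<noteq> f x} \<le> norm v"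
      using infdist_le[of "x + v" "{z. f z \<noteq> f x}" x] v by (simp add: dist_norm)
  qed
  show "norm v > 0"
    using v by auto
qed

text \<open>The witness \<open>v\<close> moves \<open>y\<close> into the other class, and its length
  exceeds the distance from \<open>x\<close> to that class by at most \<epsilon>.\<close>

lemma transferable_infdist_le:
  assumes "optimal_perturbation f x (vs x)" "y \<in> transferable f vs \<epsilon> x"
  shows "f y = f x" "infdist y {z. f z \<noteq> f x} \<le> infdist x {z. f z \<noteq> f x} + \<epsilon>"
proof -
  obtain v where fy: "f y = f x" and v: "norm v - norm (vs x) \<le> \<epsilon>" "f (y + v) \<noteq> f y"
    using assms(2) by (auto simp: transferable_def eps_solutions_def)
  show "f y = f x" by fact
  have "infdist y {z. f z \<noteq> f x} \<le> norm v"
    using infdist_le[of "y + v" "{z. f z \<noteq> f x}" y] v fy by (simp add: dist_norm)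
  then show "infdist y {z. f z \<noteq> f x} \<le> infdist x {z. f z \<noteq> f x} + \<epsilon>"
    using v norm_optimal_perturbation(1)[OF assms(1)] by linarith
qed

text \<open>The value 1 for points at distance zero keeps the gap positive there; a point with an
  optimal perturbation has positive distance to the other class.\<close>

definition distance_gap :: "'a::metric_space set \<Rightarrow> 'a \<times> 'a \<Rightarrow> real" where
  "distance_gap A = (\<lambda>(x, y). if infdist x A > 0 \<and> infdist y A > 0
     then \<bar>infdist x A - infdist y A\<bar> else 1)"

text \<open>Equal labels give both points the same opposite class, and the two directions of
  transfer bound the difference of the distances from either side. Both distances are positive, so
  the default value 1 does not arise.\<close>

lemma mutual_transfer_distance_gap_le:
  assumes "optimal_perturbation f x (vs x)" "optimal_perturbation f y (vs y)"
    and "y \<in> transferable f vs \<epsilon> x" "x \<in> transferable f vs \<epsilon> y"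
  shows "distance_gap {z. f z \<noteq> f x} (x, y) \<le> \<epsilon>"
  using transferable_infdist_le[OF assms(1,3)] transferable_infdist_le[OF assms(2,4)]
    norm_optimal_perturbation[OF assms(1)] norm_optimal_perturbation[OF assms(2)]
  by (auto simp: distance_gap_def)

lemma borel_measurable_distance_gap [measurable]:
  "distance_gap (A :: 'a::euclidean_space set) \<in> borel_measurable (borel \<Otimes>\<^sub>M borel)"
proof -
  have [measurable]: "(\<lambda>x. infdist x A) \<in> borel_measurable borel"
    by (intro borel_measurable_continuous_onI continuous_intros)
  show ?thesis
    unfolding distance_gap_def by measurable
qed

text \<open>This is right continuity at 0 of the distribution function of \<open>Z\<close>, which
  vanishes there because \<open>Z\<close> is almost surely positive.\<close>

lemma (in prob_space) tendsto_prob_le_right: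
  fixes Z :: "'a \<Rightarrow> real"
  assumes [measurable]: "random_variable borel Z" and "AE \<omega> in M. Z \<omega> > 0"
  shows "((\<lambda>\<epsilon>. prob {\<omega> \<in> space M. Z \<omega> \<le> \<epsilon>}) \<longlongrightarrow> 0) (at_right 0)"
proof -
  interpret Z: real_distribution "distr M borel Z"
    by (rule real_distribution_distr) simp
  have cdf: "cdf (distr M borel Z) \<epsilon> = prob {\<omega> \<in> space M. Z \<omega> \<le> \<epsilon>}" for \<epsilon>
    by (simp add: cdf_def measure_distr vimage_def Int_def conj_commute)
  have "prob {\<omega> \<in> space M. Z \<omega> \<le> 0} = 0"
    using assms(2) by (subst prob_eq_0) (auto elim: eventually_mono)
  then show ?thesis
    using Z.cdf_is_right_cont[of 0] by (simp add: continuous_within cdf[abs_def])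
qed

text \<open>For fixed \<open>x\<close> the gap can vanish only if \<open>y\<close> lies on the level
  set at the positive level \<open>infdist x A\<close>, a null set for the law of \<open>Y\<close>.
  Independence makes the joint law a product, so the sections decide.\<close>

lemma (in prob_space) AE_distance_gap_pos:
  fixes X Y :: "'a \<Rightarrow> real ^ 'n"
  assumes "indep_var borel X borel Y" "continuous_distribution (distr M borel Y)"
  shows "AE \<omega> in M. distance_gap A (X \<omega>, Y \<omega>) > 0"
proof -
  have [measurable]: "random_variable borel X" "random_variable borel Y"
    using assms(1) by (auto dest: indep_var_rv1 indep_var_rv2)
  let ?X = "distr M borel X" and ?Y = "distr M borel Y"
  interpret X: prob_space ?X by (rule prob_space_distr) simp
  interpret Y: prob_space ?Y by (rule prob_space_distr) simp
  interpret XY: pair_prob_space ?X ?Y ..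
  have "AE y in ?Y. distance_gap A (x, y) > 0" for x
  proof (cases "infdist x A > 0")
    case True
    from AE_infdist_neq[OF assms(2) this, of A] show ?thesis
      by eventually_elim (auto simp: distance_gap_def)
  next
    case False
    then show ?thesis by (auto simp: distance_gap_def)
  qed
  then have "AE z in ?X \<Otimes>\<^sub>M ?Y. distance_gap A z > 0"
    by (intro XY.AE_pair_measure) measurable
  moreover have "?X \<Otimes>\<^sub>M ?Y = distr M (borel \<Otimes>\<^sub>M borel) (\<lambda>\<omega>. (X \<omega>, Y \<omega>))"
    using assms(1) by (simp add: indep_var_distribution_eq)
  ultimately have "AE z in distr M (borel \<Otimes>\<^sub>M borel) (\<lambda>\<omega>. (X \<omega>, Y \<omega>)). distance_gap A z > 0"
    by metis
  then show ?thesis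
    by (subst (asm) AE_distr_iff) auto
qed

theorem theorem3p2:
  fixes f :: "real ^ 'n \<Rightarrow> nat"
    and P :: "nat \<Rightarrow> (real ^ 'n) measure"
    and vs :: "real ^ 'n \<Rightarrow> real ^ 'n"
    and i :: nat
    and M :: "'w measure"
    and X Y :: "'w \<Rightarrow> real ^ 'n"
  assumes "\<And>x. f x \<in> labels"
    and "i \<in> labels"
    and "continuous_distribution (P i)"
    and "AE x in P i. optimal_perturbation f x (vs x)"
    and "prob_space M"
    and "prob_space.indep_var M borel X borel Y"
    and "distr M borel X = P i"
    and "distr M borel Y = P i"
    and "\<And>\<epsilon>. \<epsilon> > 0 \<Longrightarrow> mutual_transfer_event M f vs X Y \<epsilon> \<in> sets M"
  shows "((\<lambda>\<epsilon>. measure M (mutual_transfer_event M f vs X Y \<epsilon>)) \<longlongrightarrow> 0) (at_right 0)"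
proof -
  interpret prob_space M by fact
  have [measurable]: "random_variable borel X" "random_variable borel Y"
    using assms(6) by (auto dest: indep_var_rv1 indep_var_rv2)
  \<comment> \<open>The opposite class depends on the label of \<open>X \<omega>\<close>, so it is
    frozen for each label \<open>j\<close>. The distance to any fixed set is continuous, so
    \<open>Z j\<close> is measurable for arbitrary \<open>f\<close>; a union bound over the two
    labels then covers the event.\<close>
  define Z where "Z j \<omega> = distance_gap {z. f z \<noteq> j} (X \<omega>, Y \<omega>)" for j \<omega>
  have [measurable]: "random_variable borel (Z j)" for j
    unfolding Z_def by measurable
  have lim: "((\<lambda>\<epsilon>. prob {\<omega> \<in> space M. Z j \<omega> \<le> \<epsilon>}) \<longlongrightarrow> 0) (at_right 0)" for j
    using AE_distance_gap_pos[OF assms(6)] assms(3,8)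
    by (intro tendsto_prob_le_right) (auto simp: Z_def)
  have "AE x in distr M borel X. optimal_perturbation f x (vs x)"
    "AE x in distr M borel Y. optimal_perturbation f x (vs x)"
    using assms(4) unfolding assms(7,8) by assumption+
  then have opt: "AE \<omega> in M. optimal_perturbation f (X \<omega>) (vs (X \<omega>))"
    "AE \<omega> in M. optimal_perturbation f (Y \<omega>) (vs (Y \<omega>))"
    by (auto dest: AE_distrD[rotated])
  have bound: "measure M (mutual_transfer_event M f vs X Y \<epsilon>)
      \<le> prob {\<omega> \<in> space M. Z 0 \<omega> \<le> \<epsilon>} + prob {\<omega> \<in> space M. Z 1 \<omega> \<le> \<epsilon>}" for \<epsilon>
  proof -
    have "prob (mutual_transfer_event M f vs X Y \<epsilon>)
        \<le> prob ({\<omega> \<in> space M. Z 0 \<omega> \<le> \<epsilon>} \<union> {\<omega> \<in> space M. Z 1 \<omega> \<le> \<epsilon>})"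
    proof (rule finite_measure_mono_AE)
      show "AE \<omega> in M. \<omega> \<in> mutual_transfer_event M f vs X Y \<epsilon> \<longrightarrow>
          \<omega> \<in> {\<omega> \<in> space M. Z 0 \<omega> \<le> \<epsilon>} \<union> {\<omega> \<in> space M. Z 1 \<omega> \<le> \<epsilon>}"
        using opt
      proof eventually_elim
        case (elim \<omega>)
        have "f (X \<omega>) = 0 \<or> f (X \<omega>) = 1"
          using assms(1)[of "X \<omega>"] by (auto simp: labels_def)
        with mutual_transfer_distance_gap_le[OF elim, of \<epsilon>] show ?case
          by (auto simp: mutual_transfer_event_def Z_def)
      qed
    qed measurable
    also have "\<dots> \<le> prob {\<omega> \<in> space M. Z 0 \<omega> \<le> \<epsilon>} + prob {\<omega> \<in> space M. Z 1 \<omega> \<le> \<epsilon>}"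
      by (rule measure_Un_le) measurable
    finally show ?thesis .
  qed
  have "((\<lambda>\<epsilon>. prob {\<omega> \<in> space M. Z 0 \<omega> \<le> \<epsilon>} + prob {\<omega> \<in> space M. Z 1 \<omega> \<le> \<epsilon>}) \<longlongrightarrow> 0)
      (at_right 0)"
    using tendsto_add[OF lim[of 0] lim[of 1]] by simp
  then show ?thesis
    by (rule tendsto_sandwich[OF _ _ tendsto_const, rotated 2]) (use bound in simp_all)
qed

end
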